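(* Let $n\ge 0$. 1. Let $\mathcal{M}$ be a model whose relation $R$ is weakly transitive. If every instance of $\mathbb{C}_n^*$ is true in $\mathcal{M}$, then every instance of $\mathbb{C}_n$ is true in $\mathcal{M}$. 2. $\mathbb{C}_n$ is included in any normal logic that includes all instances of w4 and of $\mathbb{C}_n^*$.
   Context: Modal formulas are built from variables by $\top,\neg,\wedge,\Box$, with $\Diamond=\neg\Box\neg$, $\Box^*\varphi=\varphi\wedge\Box\varphi$, $\Diamond^*\varphi=\varphi\vee\Diamond\varphi$. Models $(W,R,V)$ use standard Kripke semantics; a formula is true in a model if true at every point. $R$ is weakly transitive if $xRyRz$ implies $xRz$ or $x=z$. A normal logic is a set of formulas containing all tautologies and all instances of $\Box(\varphi\to\psi)\to(\Box\varphi\to\Box\psi)$, closed under modus ponens, $\Box$-generalisation and uniform substitution. w4 is the scheme $\Diamond\Diamond\varphi\to\Diamond^*\varphi$. Define $\mathbb{P}_0(\varphi_0)=\Diamond\varphi_0$ and for $n>0$, $\mathbb{P}_n(\varphi_0,\dots,\varphi_n)=\Diamond(\varphi_1\wedge\mathbb{P}_{n-1}(\varphi_0,\varphi_2,\dots,\varphi_n))$; $\mathbb{D}_n(\varphi_0,\dots,\varphi_n)=\bigwedge_{i<j\le n}\neg(\varphi_i\wedge\varphi_j)$ ($=\top$ if $n=0$). $\mathbb{C}_n$ is the scheme $\Box^*\mathbb{D}_n(\varphi_0,\dots,\varphi_n)\to(\Diamond\varphi_0\to\Diamond(\varphi_0\wedge\neg\mathbb{P}_n(\varphi_0,\dots,\varphi_n)))$,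 and $\mathbb{C}_n^*$ is the scheme $\Box^*\mathbb{D}_n(\varphi_0,\dots,\varphi_n)\to(\Diamond\varphi_0\to\Diamond^*(\varphi_0\wedge\neg\mathbb{P}_n(\varphi_0,\dots,\varphi_n)))$, where the $\varphi_i$ range over all formulas. *)

theory Defs
  imports Main
begin

datatype 'v fm =
    Var 'v
  | Top (\<open>\<^bold>\<top>\<close>)
  | Neg "'v fm" (\<open>\<^bold>\<not> _\<close> [60] 60)
  | And "'v fm" "'v fm" (infixr \<open>\<^bold>\<and>\<close> 45)
  | Box "'v fm" (\<open>\<^bold>\<box> _\<close> [60] 60)

abbreviation Or :: "'v fm \<Rightarrow> 'v fm \<Rightarrow> 'v fm" (infixr \<open>\<^bold>\<or>\<close> 40) where
  "\<phi> \<^bold>\<or> \<psi> \<equiv> \<^bold>\<not> (\<^bold>\<not> \<phi> \<^bold>\<and> \<^bold>\<not> \<psi>)"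

abbreviation Imp :: "'v fm \<Rightarrow> 'v fm \<Rightarrow> 'v fm" (infixr \<open>\<^bold>\<longrightarrow>\<close> 35) where
  "\<phi> \<^bold>\<longrightarrow> \<psi> \<equiv> \<^bold>\<not> (\<phi> \<^bold>\<and> \<^bold>\<not> \<psi>)"

abbreviation Dia :: "'v fm \<Rightarrow> 'v fm" (\<open>\<^bold>\<diamond> _\<close> [60] 60) where
  "\<^bold>\<diamond> \<phi> \<equiv> \<^bold>\<not> \<^bold>\<box> \<^bold>\<not> \<phi>"

definition Box_star :: "'v fm \<Rightarrow> 'v fm" (\<open>\<^bold>\<box>\<^sup>* _\<close> [60] 60) where
  "\<^bold>\<box>\<^sup>* \<phi> = (\<phi> \<^bold>\<and> \<^bold>\<box> \<phi>)"

definition Dia_star :: "'v fm \<Rightarrow> 'v fm" (\<open>\<^bold>\<diamond>\<^sup>* _\<close> [60] 60) where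
  "\<^bold>\<diamond>\<^sup>* \<phi> = (\<phi> \<^bold>\<or> \<^bold>\<diamond> \<phi>)"

fun big_and :: "'v fm list \<Rightarrow> 'v fm" where
  "big_and [] = \<^bold>\<top>"
| "big_and [\<phi>] = \<phi>"
| "big_and (\<phi> # \<psi> # \<phi>s) = (\<phi> \<^bold>\<and> big_and (\<psi> # \<phi>s))"


(* The set of worlds may be a proper subset of its type. *)

record ('v, 'w) kripke =
  worlds :: "'w set"
  acc :: "('w \<times> 'w) set"
  val :: "'v \<Rightarrow> 'w set"

definition kripke_model :: "('v, 'w) kripke \<Rightarrow> bool" where
  "kripke_model M \<longleftrightarrow>
     worlds M \<noteq> {} \<and> acc M \<subseteq> worlds M \<times> worlds M \<and> (\<forall>p. val M p \<subseteq> worlds M)"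

primrec sat :: "('v, 'w) kripke \<Rightarrow> 'w \<Rightarrow> 'v fm \<Rightarrow> bool" where
  "sat M x (Var p) \<longleftrightarrow> x \<in> val M p"
| "sat M x \<^bold>\<top> \<longleftrightarrow> True"
| "sat M x (\<^bold>\<not> \<phi>) \<longleftrightarrow> \<not> sat M x \<phi>"
| "sat M x (\<phi> \<^bold>\<and> \<psi>) \<longleftrightarrow> sat M x \<phi> \<and> sat M x \<psi>"
| "sat M x (\<^bold>\<box> \<phi>) \<longleftrightarrow> (\<forall>y. (x, y) \<in> acc M \<longrightarrow> sat M y \<phi>)"

definition true_in :: "('v, 'w) kripke \<Rightarrow> 'v fm \<Rightarrow> bool" where
  "true_in M \<phi> \<longleftrightarrow> (\<forall>x \<in> worlds M. sat M x \<phi>)"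

definition weakly_transitive :: "('w \<times> 'w) set \<Rightarrow> bool" where
  "weakly_transitive R \<longleftrightarrow>
     (\<forall>x y z. (x, y) \<in> R \<longrightarrow> (y, z) \<in> R \<longrightarrow> (x, z) \<in> R \<or> x = z)"


(* Truth-functional evaluation: variables and boxed formulas are treated as
   propositional atoms, with truth values given by the assignment v. *)

primrec tv :: "('v fm \<Rightarrow> bool) \<Rightarrow> 'v fm \<Rightarrow> bool" where
  "tv v (Var p) \<longleftrightarrow> v (Var p)"
| "tv v \<^bold>\<top> \<longleftrightarrow> True"
| "tv v (\<^bold>\<not> \<phi>) \<longleftrightarrow> \<not> tv v \<phi>"
| "tv v (\<phi> \<^bold>\<and> \<psi>) \<longleftrightarrow> tv v \<phi> \<and> tv v \<psi>"
| "tv v (\<^bold>\<box> \<phi>) \<longleftrightarrow> v (\<^bold>\<box> \<phi>)"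

definition tautology :: "'v fm \<Rightarrow> bool" where
  "tautology \<phi> \<longleftrightarrow> (\<forall>v. tv v \<phi>)"

primrec subst_fm :: "('v \<Rightarrow> 'v fm) \<Rightarrow> 'v fm \<Rightarrow> 'v fm" where
  "subst_fm \<sigma> (Var p) = \<sigma> p"
| "subst_fm \<sigma> \<^bold>\<top> = \<^bold>\<top>"
| "subst_fm \<sigma> (\<^bold>\<not> \<phi>) = \<^bold>\<not> subst_fm \<sigma> \<phi>"
| "subst_fm \<sigma> (\<phi> \<^bold>\<and> \<psi>) = (subst_fm \<sigma> \<phi> \<^bold>\<and> subst_fm \<sigma> \<psi>)"
| "subst_fm \<sigma> (\<^bold>\<box> \<phi>) = \<^bold>\<box> subst_fm \<sigma> \<phi>"

definition normal_logic :: "'v fm set \<Rightarrow> bool" where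
  "normal_logic L \<longleftrightarrow>
     (\<forall>\<phi>. tautology \<phi> \<longrightarrow> \<phi> \<in> L) \<and>
     (\<forall>\<phi> \<psi>. (\<^bold>\<box> (\<phi> \<^bold>\<longrightarrow> \<psi>) \<^bold>\<longrightarrow> (\<^bold>\<box> \<phi> \<^bold>\<longrightarrow> \<^bold>\<box> \<psi>)) \<in> L) \<and>
     (\<forall>\<phi> \<psi>. \<phi> \<in> L \<longrightarrow> (\<phi> \<^bold>\<longrightarrow> \<psi>) \<in> L \<longrightarrow> \<psi> \<in> L) \<and>
     (\<forall>\<phi>. \<phi> \<in> L \<longrightarrow> \<^bold>\<box> \<phi> \<in> L) \<and>
     (\<forall>\<phi> \<sigma>. \<phi> \<in> L \<longrightarrow> subst_fm \<sigma> \<phi> \<in> L)"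


(* A tuple of formulas (\<phi>_0, ..., \<phi>_n) is represented by a function on nat;
   only its values at 0, ..., n are used below. *)

definition w4 :: "'v fm \<Rightarrow> 'v fm" where
  "w4 \<phi> = (\<^bold>\<diamond> \<^bold>\<diamond> \<phi> \<^bold>\<longrightarrow> \<^bold>\<diamond>\<^sup>* \<phi>)"

(* The argument tuple of the recursive call is (\<phi>_0, \<phi>_2, ..., \<phi>_(n+1)). *)
primrec PP :: "nat \<Rightarrow> (nat \<Rightarrow> 'v fm) \<Rightarrow> 'v fm" where
  "PP 0 \<phi> = \<^bold>\<diamond> \<phi> 0"
| "PP (Suc n) \<phi> = \<^bold>\<diamond> (\<phi> 1 \<^bold>\<and> PP n (\<lambda>i. if i = 0 then \<phi> 0 else \<phi> (Suc i)))"

definition DD :: "nat \<Rightarrow> (nat \<Rightarrow> 'v fm) \<Rightarrow> 'v fm" where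
  "DD n \<phi> = big_and [\<^bold>\<not> (\<phi> i \<^bold>\<and> \<phi> j). j \<leftarrow> [0..<Suc n], i \<leftarrow> [0..<j]]"

definition CC :: "nat \<Rightarrow> (nat \<Rightarrow> 'v fm) \<Rightarrow> 'v fm" where
  "CC n \<phi> = (\<^bold>\<box>\<^sup>* DD n \<phi> \<^bold>\<longrightarrow> (\<^bold>\<diamond> \<phi> 0 \<^bold>\<longrightarrow> \<^bold>\<diamond> (\<phi> 0 \<^bold>\<and> \<^bold>\<not> PP n \<phi>)))"

definition CC_star :: "nat \<Rightarrow> (nat \<Rightarrow> 'v fm) \<Rightarrow> 'v fm" where
  "CC_star n \<phi> = (\<^bold>\<box>\<^sup>* DD n \<phi> \<^bold>\<longrightarrow> (\<^bold>\<diamond> \<phi> 0 \<^bold>\<longrightarrow> \<^bold>\<diamond>\<^sup>* (\<phi> 0 \<^bold>\<and> \<^bold>\<not> PP n \<phi>)))"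

end

theory Submission
  imports Defs
begin

text \<open>
  For both parts the given instance of \<open>CC_star\<close> implies the same instance of \<open>CC\<close>,
  by one derivation that uses w4 but not substitution; the formulas true in a weakly transitive
  model form a theory closed under everything it needs.  For \<open>n = 0\<close> the implication is
  propositional.  For \<open>n > 0\<close> write \<open>PP n \<phi> = \<^bold>\<diamond> \<chi>\<close>, where
  \<open>\<chi>\<close> implies \<open>\<phi> 1\<close>.  If \<open>CC\<close> failed, then \<open>\<phi> 0\<close>
  and \<open>\<^bold>\<not> \<^bold>\<diamond> \<chi>\<close> would hold here, while every successor satisfying
  \<open>\<phi> 0\<close> would satisfy \<open>\<^bold>\<diamond> \<chi>\<close>.  As there is such a successor,
  \<open>\<^bold>\<diamond> \<^bold>\<diamond> \<chi>\<close> holds, so w4 gives \<open>\<chi>\<close>, hence \<open>\<phi> 1\<close>, here,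
  against disjointness from \<open>\<phi> 0\<close>.
\<close>

lemma tv_big_and: "tv v (big_and xs) \<longleftrightarrow> (\<forall>\<phi> \<in> set xs. tv v \<phi>)"
  by (induction xs rule: big_and.induct) auto

lemma tv_DD: "tv v (DD n \<phi>) \<longleftrightarrow> (\<forall>j \<le> n. \<forall>i < j. \<not> (tv v (\<phi> i) \<and> tv v (\<phi> j)))"
  by (fastforce simp: DD_def tv_big_and less_Suc_eq_le simp del: upt_Suc)

text \<open>Taking satisfaction at \<open>x\<close> as the truth assignment shows that tautologies
  are true at \<open>x\<close>.\<close>

lemma sat_eq_tv: "sat M x \<phi> \<longleftrightarrow> tv (sat M x) \<phi>"
  by (induction \<phi>) auto

text \<open>The formulas true in one model need not be closed under substitution, so this weaker
  notion serves both parts.\<close>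

locale modal_theory =
  fixes L :: "'v fm set"
  assumes taut: "tautology \<phi> \<Longrightarrow> \<phi> \<in> L"
    and K: "(\<^bold>\<box> (\<phi> \<^bold>\<longrightarrow> \<psi>) \<^bold>\<longrightarrow> (\<^bold>\<box> \<phi> \<^bold>\<longrightarrow> \<^bold>\<box> \<psi>)) \<in> L"
    and mp: "\<phi> \<in> L \<Longrightarrow> (\<phi> \<^bold>\<longrightarrow> \<psi>) \<in> L \<Longrightarrow> \<psi> \<in> L"
    and nec: "\<phi> \<in> L \<Longrightarrow> \<^bold>\<box> \<phi> \<in> L"
begin

lemma taut_conseq:
  assumes "set \<phi>s \<subseteq> L" and "\<And>v. (\<forall>\<phi> \<in> set \<phi>s. tv v \<phi>) \<Longrightarrow> tv v \<psi>"
  shows "\<psi> \<in> L"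
  using assms
proof (induction \<phi>s arbitrary: \<psi>)
  case Nil
  then show ?case by (simp add: taut tautology_def)
next
  case (Cons \<phi> \<phi>s)
  have "(\<phi> \<^bold>\<longrightarrow> \<psi>) \<in> L"
  proof (rule Cons.IH)
    show "set \<phi>s \<subseteq> L" using Cons.prems(1) by simp
    show "tv v (\<phi> \<^bold>\<longrightarrow> \<psi>)" if "\<forall>\<phi> \<in> set \<phi>s. tv v \<phi>" for v
      using Cons.prems(2)[of v] that by simp
  qed
  then show ?case using Cons.prems(1) mp[of \<phi> \<psi>] by simp
qed

text \<open>Contrapositive: two uses of \<open>K\<close> carry the boxes of \<open>?b\<close> and of
  the negated \<open>\<psi>\<close> to that of the negated \<open>\<phi>\<close>.\<close>

lemma dia_cases: "(\<^bold>\<diamond> \<phi> \<^bold>\<longrightarrow> (\<^bold>\<diamond> (\<phi> \<^bold>\<and> \<^bold>\<not> \<psi>) \<^bold>\<or> \<^bold>\<diamond> \<psi>)) \<in> L"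
proof -
  let ?b = "\<^bold>\<not> (\<phi> \<^bold>\<and> \<^bold>\<not> \<psi>)" and ?c = "\<^bold>\<not> \<psi> \<^bold>\<longrightarrow> \<^bold>\<not> \<phi>"
  have 1: "\<^bold>\<box> (?b \<^bold>\<longrightarrow> ?c) \<in> L"
    by (intro nec taut) (auto simp: tautology_def)
  show ?thesis
    by (rule taut_conseq[of
          "[\<^bold>\<box> (?b \<^bold>\<longrightarrow> ?c),
            \<^bold>\<box> (?b \<^bold>\<longrightarrow> ?c) \<^bold>\<longrightarrow> (\<^bold>\<box> ?b \<^bold>\<longrightarrow> \<^bold>\<box> ?c),
            \<^bold>\<box> ?c \<^bold>\<longrightarrow> (\<^bold>\<box> (\<^bold>\<not> \<psi>) \<^bold>\<longrightarrow> \<^bold>\<box> (\<^bold>\<not> \<phi>))]"])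
      (use 1 in \<open>auto simp: K\<close>)
qed

lemma CC_if_CC_star:
  assumes w4: "\<And>\<psi>. w4 \<psi> \<in> L" and star: "CC_star n \<phi> \<in> L"
  shows "CC n \<phi> \<in> L"
proof (cases n)
  case 0
  \<comment> \<open>Here \<open>PP n \<phi>\<close> is the premise that \<open>\<phi> 0\<close> is
    possible, so the starred diamond cannot be witnessed at the current point.\<close>
  show ?thesis
    by (rule taut_conseq[of "[CC_star n \<phi>]"])
      (use star 0 in \<open>auto simp: CC_def CC_star_def Dia_star_def\<close>)
next
  case (Suc m)
  define \<chi> where "\<chi> = (\<phi> 1 \<^bold>\<and> PP m (\<lambda>i. if i = 0 then \<phi> 0 else \<phi> (Suc i)))"
  have PP: "PP n \<phi> = \<^bold>\<diamond> \<chi>"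
    by (simp add: Suc \<chi>_def)
  have \<chi>: "\<not> tv v (\<phi> 0) \<or> \<not> tv v \<chi>" if "tv v (DD n \<phi>)" for v
    using that[unfolded tv_DD, rule_format, of 1 0] by (auto simp: \<chi>_def Suc)
  \<comment> \<open>The last disjunct is a double diamond of \<open>\<chi>\<close>, the antecedent
    of \<open>w4 \<chi>\<close>.\<close>
  let ?\<phi>s = "[CC_star n \<phi>, w4 \<chi>, \<^bold>\<diamond> \<phi> 0 \<^bold>\<longrightarrow> (\<^bold>\<diamond> (\<phi> 0 \<^bold>\<and> \<^bold>\<not> PP n \<phi>) \<^bold>\<or> \<^bold>\<diamond> PP n \<phi>)]"
  show ?thesis
  proof (rule taut_conseq)
    show "set ?\<phi>s \<subseteq> L"
      using star w4[of \<chi>] dia_cases[of "\<phi> 0" "PP n \<phi>"] by simp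
    show "tv v (CC n \<phi>)" if "\<forall>\<psi> \<in> set ?\<phi>s. tv v \<psi>" for v
      using that \<chi>[of v] by (auto simp: CC_def CC_star_def w4_def Box_star_def Dia_star_def PP)
  qed
qed

end

lemma modal_theory_if_normal_logic: "normal_logic L \<Longrightarrow> modal_theory L"
  unfolding normal_logic_def modal_theory_def by blast

lemma modal_theory_true_in:
  assumes "kripke_model M"
  shows "modal_theory {\<phi>. true_in M \<phi>}"
proof
  show "\<phi> \<in> {\<phi>. true_in M \<phi>}" if "tautology \<phi>" for \<phi>
    unfolding mem_Collect_eq true_in_def
    by (intro ballI iffD2[OF sat_eq_tv] that[unfolded tautology_def, rule_format])
qed (use assms in \<open>auto simp: kripke_model_def true_in_def\<close>)

lemma true_in_w4: "weakly_transitive (acc M) \<Longrightarrow> true_in M (w4 \<phi>)"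
  unfolding true_in_def w4_def Dia_star_def weakly_transitive_def by fastforce

theorem theorem5p2:
  fixes n :: nat
  shows
    "(\<forall>M :: ('v, 'w) kripke.
        kripke_model M \<longrightarrow> weakly_transitive (acc M) \<longrightarrow>
        (\<forall>\<phi>. true_in M (CC_star n \<phi>)) \<longrightarrow> (\<forall>\<phi>. true_in M (CC n \<phi>))) \<and>
     (\<forall>L :: 'v fm set.
        normal_logic L \<longrightarrow> (\<forall>\<phi>. w4 \<phi> \<in> L) \<longrightarrow> (\<forall>\<phi>. CC_star n \<phi> \<in> L) \<longrightarrow>
        (\<forall>\<phi>. CC n \<phi> \<in> L))"
proof (intro conjI allI impI)
  fix M :: "('v, 'w) kripke" and \<phi>
  assume "kripke_model M" and "weakly_transitive (acc M)" and "\<forall>\<phi>. true_in M (CC_star n \<phi>)"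
  then have "CC n \<phi> \<in> {\<phi>. true_in M \<phi>}"
    by (intro modal_theory.CC_if_CC_star[OF modal_theory_true_in]) (auto intro: true_in_w4)
  then show "true_in M (CC n \<phi>)" by simp
next
  fix L :: "'v fm set" and \<phi>
  assume "normal_logic L" and "\<forall>\<phi>. w4 \<phi> \<in> L" and "\<forall>\<phi>. CC_star n \<phi> \<in> L"
  then show "CC n \<phi> \<in> L"
    by (intro modal_theory.CC_if_CC_star[OF modal_theory_if_normal_logic]) auto
qed

end
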